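(* Let $\varphi:\mathbb{R}_+\to\mathbb{R}_+$ be continuous and absolutely continuous, and let $\varphi^\natural$ be its tamping. Then $\varphi(0)=\varphi^\natural(0)$.
   Context: $\mathbb{R}_+=[0,+\infty)$, $\mathrm{meas}$ is Lebesgue measure, $\mathfrak{M}_+(\mathbb{R}_+)$ is the set of non-negative measurable functions on $\mathbb{R}_+$, and $\{\varphi\ge\nu\}=\{x\in\mathbb{R}_+:\varphi(x)\ge\nu\}$. Hollows. For $A\subseteq\mathbb{R}_+$ measurable, the essential convex hull is $\mathrm{conv\,ess}\,A:=\bigcap_{\mathrm{meas}(A\triangle B)=0}\mathrm{conv}\,B$. The hollows of $A$ are $\mathcal{H}(A):=(\mathrm{conv\,ess}\,A)\setminus A$ (understood up to null sets). For $\varphi\in\mathfrak{M}_+(\mathbb{R}_+)$ and $\nu\in(0,+\infty]$, $\mathcal{H}_\nu(\varphi):=\bigcup_{\lambda<\nu}\mathcal{H}(\{\varphi\ge\lambda\})$. Tamping. For $\nu>0$ let $x_\nu(\varphi):=\mathrm{inf\,ess}\{\varphi\ge\nu\}$, where $\mathrm{inf\,ess}\,A:=\sup\{a\ge0:\mathrm{meas}(A\cap[0,a])=0\}$, and, when $\mathrm{meas}\{\varphi\ge\nu\}>0$, $y_\nu(\varphi):=x_\nu(\varphi)-\mathrm{meas}(\mathcal{H}_\infty(\varphi)\cap[0,x_\nu(\varphi)])$. Put $S_\nu(\varphi):=[\,y_\nu(\varphi),\,y_\nu(\varphi)+\mathrm{meas}\{\varphi\ge\nu\}\,]$ (meaning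 $[y_\nu(\varphi),+\infty)$ if $\mathrm{meas}\{\varphi\ge\nu\}=+\infty$, and $\emptyset$ if $\mathrm{meas}\{\varphi\ge\nu\}=0$). These sets are non-increasing in $\nu$. The tamping $\varphi^\natural:\mathbb{R}_+\to[0,+\infty]$ of $\varphi$ is the function whose superlevel sets $\{\varphi^\natural\ge\nu\}$ are the $S_\nu(\varphi)$; explicitly (and this fixes its value at each point, in particular at $0$) $\varphi^\natural(x):=\sup\{\nu>0: x\in S_\nu(\varphi)\}$ with $\sup\emptyset=0$. *)

theory Defs
  imports "HOL-Analysis.Analysis"
begin

text \<open>
  Subsets of \<open>[0,\<infinity>)\<close> are of type \<^typ>\<open>real set\<close>, and a function on \<open>[0,\<infinity>)\<close> is a
  function on \<^typ>\<open>real\<close> of which only the values on \<open>{0..}\<close> are used.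
\<close>

definition absolutely_continuous_on :: "real set \<Rightarrow> (real \<Rightarrow> real) \<Rightarrow> bool" where
  "absolutely_continuous_on I f \<longleftrightarrow>
     (\<forall>\<epsilon>>0. \<exists>\<delta>>0. \<forall>(n::nat) (a::nat \<Rightarrow> real) b.
        (\<forall>i<n. a i \<le> b i \<and> {a i..b i} \<subseteq> I) \<and>
        (\<forall>i<n. \<forall>j<n. i \<noteq> j \<longrightarrow> {a i<..<b i} \<inter> {a j<..<b j} = {}) \<and>
        (\<Sum>i<n. b i - a i) < \<delta> \<longrightarrow>
        (\<Sum>i<n. \<bar>f (b i) - f (a i)\<bar>) < \<epsilon>)"

definition superlevel :: "(real \<Rightarrow> real) \<Rightarrow> real \<Rightarrow> real set" where
  "superlevel \<phi> \<nu> = {x. 0 \<le> x \<and> \<nu> \<le> \<phi> x}"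

definition conv_ess :: "real set \<Rightarrow> real set" where
  "conv_ess A = \<Inter> {convex hull B | B. B \<subseteq> {0..} \<and> sym_diff A B \<in> null_sets lebesgue}"

definition hollows :: "real set \<Rightarrow> real set" where
  "hollows A = conv_ess A - A"

text \<open>
  The union below ranges over uncountably many levels, and each set \<open>hollows A\<close> matters only
  up to a null set. Since \<open>conv_ess\<close> is antitone, and \<open>A\<close> is here the actual superlevel set,
  the union equals the countable one over rational levels.
\<close>

definition hollows_below :: "ereal \<Rightarrow> (real \<Rightarrow> real) \<Rightarrow> real set" where
  "hollows_below \<nu> \<phi> = (\<Union>l\<in>{l::real. ereal l < \<nu>}. hollows (superlevel \<phi> l))"

text \<open>The value is \<open>\<infinity>\<close> exactly when \<open>A \<inter> {0..}\<close> is a null set.\<close>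

definition inf_ess :: "real set \<Rightarrow> ereal" where
  "inf_ess A = Sup (ereal ` {a. 0 \<le> a \<and> A \<inter> {0..a} \<in> null_sets lebesgue})"

text \<open>
  The next two quantities are meaningful only if \<open>superlevel \<phi> \<nu>\<close> has positive measure;
  then \<open>inf_ess\<close> is finite and \<open>real_of_ereal\<close> loses nothing.
\<close>

definition tamp_x :: "real \<Rightarrow> (real \<Rightarrow> real) \<Rightarrow> real" where
  "tamp_x \<nu> \<phi> = real_of_ereal (inf_ess (superlevel \<phi> \<nu>))"

definition tamp_y :: "real \<Rightarrow> (real \<Rightarrow> real) \<Rightarrow> real" where
  "tamp_y \<nu> \<phi> = tamp_x \<nu> \<phi> - measure lebesgue (hollows_below \<infinity> \<phi> \<inter> {0..tamp_x \<nu> \<phi>})"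

definition tamp_set :: "real \<Rightarrow> (real \<Rightarrow> real) \<Rightarrow> real set" where
  "tamp_set \<nu> \<phi> =
     (if emeasure lebesgue (superlevel \<phi> \<nu>) = 0 then {}
      else if emeasure lebesgue (superlevel \<phi> \<nu>) = \<infinity> then {tamp_y \<nu> \<phi>..}
      else {tamp_y \<nu> \<phi>..tamp_y \<nu> \<phi> + measure lebesgue (superlevel \<phi> \<nu>)})"

text \<open>In \<^typ>\<open>ennreal\<close> the supremum of the empty set is \<open>0\<close>.\<close>

definition tamping :: "(real \<Rightarrow> real) \<Rightarrow> real \<Rightarrow> ennreal" where
  "tamping \<phi> x = Sup (ennreal ` {\<nu>. 0 < \<nu> \<and> x \<in> tamp_set \<nu> \<phi>})"

end

theory Submission
  imports Defs
begin

text \<open>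
  Call \<open>x\<close> a record point of \<open>\<phi>\<close> if \<open>\<phi> t \<le> \<phi> x\<close> for all \<open>t \<in> [0, x]\<close>. A level set that misses a record
  point lies entirely to its right, so record points avoid all hollows. On \<open>[0, c]\<close> the record
  points are mapped onto a set containing \<open>[\<phi> 0, \<phi> c]\<close>; an absolutely continuous function maps null
  sets to null sets (Lusin's property), so if \<open>\<phi> 0 < \<phi> c\<close> then the record points have positive
  measure. For \<open>\<nu> > \<phi> 0\<close> and \<open>c = x\<^sub>\<nu>\<close> this gives \<open>y\<^sub>\<nu> > 0\<close>, so \<open>0 \<notin> S\<^sub>\<nu>\<close>; for \<open>\<nu> < \<phi> 0\<close>
  continuity gives \<open>x\<^sub>\<nu> = y\<^sub>\<nu> = 0\<close>.
\<close>

section \<open>Lusin's property of absolutely continuous functions on compact null sets\<close>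

text \<open>Compactness turns an open cover of small measure into finitely many intervals, as the
  finite sums of absolute continuity require. On each of them the image is controlled by the
  oscillation, which is a difference of two values of \<open>f\<close>.\<close>

lemma compact_null_image_absolutely_continuous:
  fixes f :: "real \<Rightarrow> real"
  assumes cont: "continuous_on {a..b} f" and ac: "absolutely_continuous_on {a..b} f"
    and S: "compact S" "S \<subseteq> {a..b}" "negligible S"
  shows "negligible (f ` S)"
  unfolding negligible_outer_le
proof (intro allI impI)
  fix e :: real assume "e > 0"
  then obtain d where "d > 0" and d: "\<And>n l r.
        (\<forall>i<n. l i \<le> r i \<and> {l i..r i} \<subseteq> {a..b}) \<Longrightarrow>
        (\<forall>i<n. \<forall>j<n. i \<noteq> j \<longrightarrow> {l i<..<r i} \<inter> {l j<..<r j} = {}) \<Longrightarrow>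
        (\<Sum>i<(n::nat). r i - l i) < d \<Longrightarrow> (\<Sum>i<n. \<bar>f (r i) - f (l i)\<bar>) < e"
    using ac unfolding absolutely_continuous_on_def by meson
  obtain U where U: "open U" "S \<subseteq> U" "U \<in> lmeasurable" "measure lebesgue U < d"
  proof -
    have "S \<in> sets lebesgue" "emeasure lebesgue S = 0"
      using S(3) by (auto simp: negligible_iff_null_sets)
    from sets_lebesgue_outer_open[OF this(1) \<open>d > 0\<close>] obtain U
      where U: "open U" "S \<subseteq> U" "(U - S) \<in> lmeasurable" "emeasure lebesgue (U - S) < ennreal d"
      by blast
    have "U = (U - S) \<union> S" using U(2) by blast
    then have "U \<in> lmeasurable"
      using U(3) S(3) by (metis fmeasurable.Un negligible_imp_measurable)
    moreover have "measure lebesgue U = measure lebesgue (U - S)"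
      using S(3) U(2) by (simp add: measurable_measure_Diff negligible_iff_null_sets
          \<open>U \<in> lmeasurable\<close> measure_Diff_null_set fmeasurableD)
    moreover have "measure lebesgue (U - S) < d"
      using U(4) \<open>d > 0\<close> U(3) by (metis emeasure_eq_measure2 ennreal_less_iff measure_nonneg)
    ultimately show thesis using U that by auto
  qed
  have "\<exists>l r. x \<in> {l<..<r} \<and> {l..r} \<subseteq> U" if "x \<in> S" for x
  proof -
    obtain \<eta> where "\<eta> > 0" "cball x \<eta> \<subseteq> U"
      using U(1,2) \<open>x \<in> S\<close> open_contains_cball by blast
    then show ?thesis
      by (intro exI[of _ "x - \<eta>"] exI[of _ "x + \<eta>"]) (auto simp: cball_eq_atLeastAtMost)
  qed
  then obtain l r where lr: "\<And>x. x \<in> S \<Longrightarrow> x \<in> {l x<..<r x} \<and> {l x..r x} \<subseteq> U"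
    by metis
  obtain C where C: "C \<subseteq> S" "finite C" "S \<subseteq> (\<Union>x\<in>C. {l x<..<r x})"
    by (rule compactE_image[OF S(1), of S "\<lambda>x. {l x<..<r x}"]) (use lr in auto)
  \<comment> \<open>Clipping to \<open>{a..b}\<close> is needed because absolute continuity only
    speaks of subintervals of it. The clipped intervals may overlap; the division \<open>p\<close>
    of their union consists of non-overlapping ones.\<close>
  define F where "F = (\<lambda>x. cbox (max a (l x)) (min b (r x))) ` C"
  have "finite F" "\<And>s. s \<in> F \<Longrightarrow> \<exists>a b. s = cbox a b"
    using C unfolding F_def by blast+
  then obtain p where p: "p division_of (\<Union>F)"
    using elementary_unions_intervals by blast
  have FU: "\<Union>F \<subseteq> U" using lr C(1) by (force simp: F_def)
  have Fab: "\<Union>F \<subseteq> {a..b}" by (auto simp: F_def)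
  have SF: "S \<subseteq> \<Union>F" using C(3) S(2) by (force simp: F_def)
  have "finite p" using p by blast
  have pI: "\<exists>l r. l \<le> r \<and> K = {l..r} \<and> {l..r} \<subseteq> {a..b}" if "K \<in> p" for K
  proof -
    obtain l r where "K = {l..r}" using division_ofD(4)[OF p \<open>K \<in> p\<close>] by auto
    moreover have "K \<noteq> {}" "K \<subseteq> {a..b}" using division_ofD(2,3)[OF p that] Fab by blast+
    ultimately show ?thesis by (intro exI[of _ l] exI[of _ r]) auto
  qed
  \<comment> \<open>\<open>s\<close> and \<open>t\<close> will be points where \<open>f\<close>
    attains its minimum and maximum on \<open>K\<close>.\<close>
  have "\<exists>s t. s \<in> K \<and> t \<in> K \<and> f ` K \<subseteq> {f s..f t}" if "K \<in> p" for K
  proof -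
    from pI[OF that] obtain l r where *: "l \<le> r" "K = {l..r}" "{l..r} \<subseteq> {a..b}" by blast
    then have "compact K" "K \<noteq> {}" "continuous_on K f"
      using continuous_on_subset[OF cont] by auto
    then obtain s t where "s \<in> K" "t \<in> K" "\<forall>x\<in>K. f s \<le> f x" "\<forall>x\<in>K. f x \<le> f t"
      using continuous_attains_inf[of K f] continuous_attains_sup[of K f] by metis
    then show ?thesis by (intro exI[of _ s] exI[of _ t]) auto
  qed
  then obtain s t where st: "\<And>K. K \<in> p \<Longrightarrow> s K \<in> K \<and> t K \<in> K \<and> f ` K \<subseteq> {f (s K)..f (t K)}"
    by metis
  obtain h where h: "bij_betw h {..<card p} p"
    using ex_bij_betw_nat_finite[OF \<open>finite p\<close>] by (auto simp: atLeast0LessThan)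
  have hp: "h i \<in> p" if "i < card p" for i using h that by (auto simp: bij_betw_def)
  \<comment> \<open>The two extremal points in increasing order. The intervals from
    \<open>u i\<close> to \<open>v i\<close> stay inside the pieces of the division, so they inherit
    disjoint interiors and small total length, while their increments of \<open>f\<close> are the
    full oscillations.\<close>
  define u where "u i = min (s (h i)) (t (h i))" for i
  define v where "v i = max (s (h i)) (t (h i))" for i
  have uv: "u i \<le> v i \<and> {u i..v i} \<subseteq> h i" if i: "i < card p" for i
  proof -
    obtain l r where "h i = {l..r}" using pI[OF hp[OF i]] by blast
    moreover have "s (h i) \<in> h i" "t (h i) \<in> h i" using st[OF hp[OF i]] by blast+
    ultimately show ?thesis unfolding u_def v_def by auto
  qed
  have len: "v i - u i \<le> measure lebesgue (h i)" if i: "i < card p" for i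
  proof -
    obtain l r where "h i = {l..r}" "l \<le> r" using pI[OF hp[OF i]] by blast
    then show ?thesis using uv[OF i] by auto
  qed
  have "(\<Sum>i<card p. \<bar>f (v i) - f (u i)\<bar>) < e"
  proof (rule d)
    have "h i \<subseteq> {a..b}" if "i < card p" for i using pI[OF hp[OF that]] by blast
    then show "\<forall>i<card p. u i \<le> v i \<and> {u i..v i} \<subseteq> {a..b}"
      using uv by (meson order_trans)
    show "\<forall>i<card p. \<forall>j<card p. i \<noteq> j \<longrightarrow> {u i<..<v i} \<inter> {u j<..<v j} = {}"
    proof (intro allI impI)
      fix i j assume ij: "i < card p" "j < card p" "i \<noteq> j"
      then have "h i \<noteq> h j" using h by (auto simp: bij_betw_def inj_on_def)
      then have "interior (h i) \<inter> interior (h j) = {}"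
        using division_ofD(5)[OF p] hp ij by blast
      moreover have "{u i<..<v i} \<subseteq> interior (h i)" "{u j<..<v j} \<subseteq> interior (h j)"
        using uv[OF ij(1)] uv[OF ij(2)] greaterThanLessThan_subseteq_atLeastAtMost_iff
        by (meson interior_maximal open_greaterThanLessThan order_refl order_trans)+
      ultimately show "{u i<..<v i} \<inter> {u j<..<v j} = {}" by blast
    qed
    have "(\<Sum>i<card p. v i - u i) \<le> (\<Sum>i<card p. measure lebesgue (h i))"
      by (rule sum_mono) (use len in auto)
    also have "\<dots> = (\<Sum>K\<in>p. measure lebesgue K)"
      by (rule sum.reindex_bij_betw[OF h])
    also have "\<dots> = measure lebesgue (\<Union>F)" by (rule content_division[OF p])
    also have "\<dots> \<le> measure lebesgue U"
      using FU U(3) lmeasurable_division[OF p] by (intro measure_mono_fmeasurable) auto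
    finally show "(\<Sum>i<card p. v i - u i) < d" using U(4) by simp
  qed
  moreover have "\<bar>f (v i) - f (u i)\<bar> = \<bar>f (t (h i)) - f (s (h i))\<bar>" for i
    by (auto simp: u_def v_def min_def max_def)
  ultimately have sum: "(\<Sum>K\<in>p. \<bar>f (t K) - f (s K)\<bar>) < e"
    using sum.reindex_bij_betw[OF h, of "\<lambda>K. \<bar>f (t K) - f (s K)\<bar>"] by simp
  let ?T = "\<Union>K\<in>p. {f (s K)..f (t K)}"
  have "f ` S \<subseteq> ?T"
  proof
    fix y assume "y \<in> f ` S"
    then obtain x where "x \<in> S" "y = f x" by blast
    moreover obtain K where "K \<in> p" "x \<in> K"
      using SF division_ofD(6)[OF p] \<open>x \<in> S\<close> by blast
    ultimately show "y \<in> ?T" using st by blast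
  qed
  moreover have "?T \<in> lmeasurable"
    using \<open>finite p\<close> by (intro fmeasurable.finite_UN) auto
  moreover have "measure lebesgue ?T \<le> (\<Sum>K\<in>p. measure lebesgue {f (s K)..f (t K)})"
    using \<open>finite p\<close> by (rule measure_UNION_le) auto
  moreover have "\<dots> \<le> (\<Sum>K\<in>p. \<bar>f (t K) - f (s K)\<bar>)"
    by (rule sum_mono) auto
  ultimately show "\<exists>T. f ` S \<subseteq> T \<and> T \<in> lmeasurable \<and> measure lebesgue T \<le> e"
    using sum by (intro exI[of _ ?T]) auto
qed

section \<open>Record points and how they avoid the hollows\<close>

definition record_points :: "real \<Rightarrow> real \<Rightarrow> (real \<Rightarrow> real) \<Rightarrow> real set" where
  "record_points a b f = {x \<in> {a..b}. \<forall>t\<in>{a..x}. f t \<le> f x}"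

lemma compact_record_points:
  assumes "continuous_on {a..b} f"
  shows "compact (record_points a b f)"
proof -
  \<comment> \<open>With \<open>min t x\<close> in place of \<open>t\<close>, the condition is
    trivial for \<open>x < t\<close>. The range of \<open>t\<close> thus no longer depends on
    \<open>x\<close>, and the record points become an intersection of closed sets.\<close>
  have closed: "closed {x \<in> {a..b}. f (min t x) \<le> f x}" if "t \<in> {a..b}" for t
    using that by (intro continuous_on_closed_Collect_le continuous_on_compose2[OF assms] assms
        continuous_intros) auto
  have "record_points a b f = {a..b} \<inter> (\<Inter>t\<in>{a..b}. {x \<in> {a..b}. f (min t x) \<le> f x})"
    by (auto simp: record_points_def min_def)
  moreover have "closed (\<Inter>t\<in>{a..b}. {x \<in> {a..b}. f (min t x) \<le> f x})"
    by (rule closed_INT[OF ballI[OF closed]])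
  ultimately show ?thesis by (simp only: compact_Int_closed[OF compact_Icc])
qed

text \<open>The first point at which \<open>f\<close> reaches the level \<open>v\<close> is a record
  point, and by the intermediate value theorem its value is exactly \<open>v\<close>.\<close>

lemma image_record_points:
  assumes "continuous_on {a..b} f" "a \<le> b"
  shows "{f a..f b} \<subseteq> f ` record_points a b f"
proof
  fix v assume v: "v \<in> {f a..f b}"
  let ?E = "{x \<in> {a..b}. v \<le> f x}"
  have "closed ?E"
    by (intro continuous_on_closed_Collect_le assms continuous_intros)
  then have "compact ?E"
    unfolding compact_eq_bounded_closed
    by (auto intro: bounded_subset[OF bounded_closed_interval[of a b]])
  moreover have "b \<in> ?E" using assms v by auto
  ultimately obtain x where x: "x \<in> ?E" and least: "\<And>t. t \<in> ?E \<Longrightarrow> x \<le> t"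
    by (metis (no_types, lifting) compact_attains_inf empty_iff)
  have "continuous_on {a..x} f" using x assms by (auto intro: continuous_on_subset)
  then obtain t where t: "a \<le> t" "t \<le> x" "f t = v"
    using IVT'[of f a v x] x v by auto
  then have "f x = v" using least[of t] x by force
  moreover have "f s \<le> v" if "a \<le> s" "s \<le> x" for s
    using that least[of s] x \<open>f x = v\<close> by force
  ultimately show "v \<in> f ` record_points a b f"
    using x by (auto simp: record_points_def image_iff)
qed

lemma measure_record_points_pos:
  assumes "continuous_on {a..b} f" "absolutely_continuous_on {a..b} f" "a \<le> b" "f a < f b"
  shows "measure lebesgue (record_points a b f) > 0"
proof (rule ccontr)
  assume "\<not> ?thesis"
  then have "negligible (record_points a b f)"
    using compact_record_points[OF assms(1)]
    by (simp add: lmeasurable_compact negligible_iff_measure zero_less_measure_iff)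
  then have "negligible (f ` record_points a b f)"
    by (intro compact_null_image_absolutely_continuous[OF assms(1,2)] compact_record_points assms)
      (auto simp: record_points_def)
  then have "negligible {f a..f b}"
    using image_record_points[OF assms(1,3)] negligible_subset by blast
  then show False using assms(4) negligible_interval(1)[of "f a" "f b"] by (auto simp: box_real)
qed

lemma hollows_record_points:
  "hollows_below \<nu> \<phi> \<inter> record_points 0 b \<phi> = {}"
proof -
  have "x \<notin> conv_ess (superlevel \<phi> l)" if x: "x \<in> record_points 0 b \<phi>" "x \<notin> superlevel \<phi> l" for x l
  proof -
    \<comment> \<open>The superlevel set is itself an admissible \<open>B\<close> in the
      intersection, so its ordinary convex hull is an upper bound.\<close>
    have "conv_ess (superlevel \<phi> l) \<subseteq> convex hull (superlevel \<phi> l)"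
      unfolding conv_ess_def
      by (rule Inter_lower, rule CollectI, rule exI[of _ "superlevel \<phi> l"]) (auto simp: superlevel_def)
    also have "\<dots> \<subseteq> {x<..}"
    proof (rule hull_minimal)
      show "superlevel \<phi> l \<subseteq> {x<..}"
      proof
        fix y assume "y \<in> superlevel \<phi> l"
        then show "y \<in> {x<..}"
          using x by (cases "y \<le> x") (auto simp: record_points_def superlevel_def intro: order_trans)
      qed
    qed (rule convex_real_interval)
    finally show ?thesis by blast
  qed
  then show ?thesis by (auto simp: hollows_below_def hollows_def)
qed

section \<open>The essential infimum of a superlevel set\<close>

lemma superlevel_Int_null_iff:
  "superlevel \<phi> \<nu> \<inter> {0..a} \<in> null_sets lebesgue \<longleftrightarrow> negligible (superlevel \<phi> \<nu> \<inter> {0..a})"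
  by (simp add: negligible_iff_null_sets)

text \<open>These facts replace the extended-real definition by a real supremum. The admissible
  \<open>a\<close> are bounded, since otherwise the superlevel set would be a countable union of
  null sets.\<close>

lemma tamp_x_properties:
  assumes "emeasure lebesgue (superlevel \<phi> \<nu>) \<noteq> 0"
  shows tamp_x_nonneg: "0 \<le> tamp_x \<nu> \<phi>"
    and negligible_below_tamp_x: "a < tamp_x \<nu> \<phi> \<Longrightarrow> negligible (superlevel \<phi> \<nu> \<inter> {0..a})"
    and le_tamp_x: "0 \<le> a \<Longrightarrow> negligible (superlevel \<phi> \<nu> \<inter> {0..a}) \<Longrightarrow> a \<le> tamp_x \<nu> \<phi>"
proof -
  let ?A = "superlevel \<phi> \<nu>"
  define E where "E = {a. 0 \<le> a \<and> negligible (?A \<inter> {0..a})}"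
  have "0 \<in> E" by (auto simp: E_def intro: negligible_subset[of "{0}"])
  have down: "negligible (?A \<inter> {0..a})" if "b \<in> E" "a \<le> b" for a b
    using that by (auto simp: E_def intro: negligible_subset)
  have "\<exists>M. \<forall>a\<in>E. a \<le> M"
  proof (rule ccontr)
    assume "\<not> ?thesis"
    then have "negligible (?A \<inter> {0..real n})" for n
      using down by (meson less_eq_real_def not_le)
    then have "negligible (\<Union>n. ?A \<inter> {0..real n})" by (rule negligible_Union_nat)
    moreover have "(\<Union>n. ?A \<inter> {0..real n}) = ?A"
      using real_arch_simple by (auto simp: superlevel_def)
    ultimately show False using assms by (auto simp: negligible_iff_null_sets)
  qed
  then obtain M where M: "\<And>a. a \<in> E \<Longrightarrow> a \<le> M" by blast
  have bdd: "bdd_above E" using M by (rule bdd_aboveI)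
  have "(SUP a\<in>E. ereal a) \<le> ereal M" by (rule SUP_least) (use M in simp)
  moreover have "ereal 0 \<le> (SUP a\<in>E. ereal a)" by (rule SUP_upper) fact
  ultimately have "\<bar>SUP a\<in>E. ereal a\<bar> \<noteq> \<infinity>" by auto
  from ereal_Sup[OF this] have x: "tamp_x \<nu> \<phi> = Sup E"
    by (metis (no_types, lifting) E_def inf_ess_def superlevel_Int_null_iff tamp_x_def Collect_cong
        real_of_ereal.simps(1))
  show "0 \<le> tamp_x \<nu> \<phi>" unfolding x by (rule cSup_upper) fact+
  show "0 \<le> a \<Longrightarrow> negligible (?A \<inter> {0..a}) \<Longrightarrow> a \<le> tamp_x \<nu> \<phi>"
    unfolding x by (rule cSup_upper) (auto simp: E_def bdd[unfolded E_def])
  show "negligible (?A \<inter> {0..a})" if "a < tamp_x \<nu> \<phi>"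
    using that \<open>0 \<in> E\<close> bdd down unfolding x by (metis empty_iff less_cSupD less_imp_le)
qed

text \<open>If \<phi> were below \<nu> at this point, it would stay so nearby by continuity, and the
  initial segment in which the superlevel set is null could be prolonged.\<close>

lemma level_at_tamp_x:
  assumes cont: "continuous_on {0..} \<phi>"
    and nz: "emeasure lebesgue (superlevel \<phi> \<nu>) \<noteq> 0"
  shows "\<nu> \<le> \<phi> (tamp_x \<nu> \<phi>)"
proof (rule ccontr)
  define c where "c = tamp_x \<nu> \<phi>"
  assume "\<not> ?thesis"
  then have "\<phi> c < \<nu>" by (simp add: c_def)
  moreover have "c \<in> {0..}" using tamp_x_nonneg[OF nz] by (simp add: c_def)
  ultimately obtain \<eta> where "\<eta> > 0"
    and "\<forall>x\<in>{0..}. dist x c < \<eta> \<longrightarrow> dist (\<phi> x) (\<phi> c) < \<nu> - \<phi> c"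
    using cont unfolding continuous_on_iff by (meson diff_gt_0_iff_gt)
  then have \<eta>: "\<phi> x < \<nu>" if "0 \<le> x" "\<bar>x - c\<bar> < \<eta>" for x
    using that by (auto simp: dist_real_def dest!: bspec[of _ _ x])
  \<comment> \<open>If \<open>c - \<eta> / 2\<close> is negative, the interval is empty and the
    claim still holds.\<close>
  have "negligible (superlevel \<phi> \<nu> \<inter> {0..c - \<eta> / 2})"
    using \<open>\<eta> > 0\<close> by (intro negligible_below_tamp_x[OF nz]) (simp add: c_def)
  moreover have "superlevel \<phi> \<nu> \<inter> {0..c + \<eta> / 2} \<subseteq> superlevel \<phi> \<nu> \<inter> {0..c - \<eta> / 2}"
  proof
    fix x assume x: "x \<in> superlevel \<phi> \<nu> \<inter> {0..c + \<eta> / 2}"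
    then have "\<not> \<bar>x - c\<bar> < \<eta>" using \<eta>[of x] by (auto simp: superlevel_def)
    then show "x \<in> superlevel \<phi> \<nu> \<inter> {0..c - \<eta> / 2}" using x \<open>\<eta> > 0\<close> by auto
  qed
  ultimately have "negligible (superlevel \<phi> \<nu> \<inter> {0..c + \<eta> / 2})"
    using negligible_subset by blast
  then have "c + \<eta> / 2 \<le> c"
    using le_tamp_x[OF nz, of "c + \<eta> / 2"] \<open>c \<in> {0..}\<close> \<open>\<eta> > 0\<close> unfolding c_def by simp
  then show False using \<open>\<eta> > 0\<close> by simp
qed

section \<open>The left end of the tamped level sets, for levels above and below the value at
  0\<close>

lemma tamp_y_pos:
  assumes cont: "continuous_on {0..} \<phi>"
    and ac: "\<And>b. 0 \<le> b \<Longrightarrow> absolutely_continuous_on {0..b} \<phi>"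
    and nz: "emeasure lebesgue (superlevel \<phi> \<nu>) \<noteq> 0"
    and "\<phi> 0 < \<nu>"
  shows "0 < tamp_y \<nu> \<phi>"
proof -
  define c where "c = tamp_x \<nu> \<phi>"
  let ?H = "hollows_below \<infinity> \<phi> \<inter> {0..c}"
  let ?R = "record_points 0 c \<phi>"
  have "0 \<le> c" using tamp_x_nonneg[OF nz] by (simp add: c_def)
  have "\<phi> 0 < \<phi> c" using level_at_tamp_x[OF cont nz] \<open>\<phi> 0 < \<nu>\<close> by (simp add: c_def)
  have cont': "continuous_on {0..c} \<phi>" using cont by (rule continuous_on_subset) auto
  have R: "?R \<in> lmeasurable" "?R \<subseteq> {0..c}"
    using compact_record_points[OF cont'] by (auto simp: lmeasurable_compact record_points_def)
  have R_pos: "measure lebesgue ?R > 0"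
    using cont' ac \<open>0 \<le> c\<close> \<open>\<phi> 0 < \<phi> c\<close> by (intro measure_record_points_pos)
  \<comment> \<open>An interval containing a set of positive measure cannot be a single
    point.\<close>
  have "measure lebesgue ?R \<le> measure lebesgue {0..c}"
    using R by (intro measure_mono_fmeasurable) auto
  then have "0 < c" using R_pos \<open>0 \<le> c\<close> by simp
  \<comment> \<open>\<open>measure\<close> of a non-measurable set is \<open>0\<close>, so measurability of the hollows is never needed.\<close>
  have "measure lebesgue ?H < c"
  proof (cases "?H \<in> sets lebesgue")
    case True
    have "?H \<subseteq> {0..c} - ?R" using hollows_record_points[of \<infinity> \<phi> c] by blast
    then have "measure lebesgue ?H \<le> measure lebesgue ({0..c} - ?R)"
      using True R by (intro measure_mono_fmeasurable fmeasurable.Diff) auto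
    also have "\<dots> = c - measure lebesgue ?R"
      using R \<open>0 \<le> c\<close> by (subst measurable_measure_Diff) auto
    finally show ?thesis using R_pos by simp
  qed (simp add: measure_notin_sets \<open>0 < c\<close>)
  then show ?thesis by (simp add: tamp_y_def c_def)
qed

text \<open>Near 0 the function exceeds \<nu>, so no initial segment of positive length meets the
  superlevel set in a null set. Hence \<open>tamp_x\<close> is 0, there is no room for hollows
  before it, and 0 is the left end of the tamped set.\<close>

lemma zero_in_tamp_set:
  assumes cont: "continuous_on {0..} \<phi>" and "\<nu> < \<phi> 0"
  shows "0 \<in> tamp_set \<nu> \<phi>"
proof -
  have "(0::real) \<in> {0..}" by simp
  then obtain \<eta> where "\<eta> > 0"
    and "\<forall>x\<in>{0..}. dist x 0 < \<eta> \<longrightarrow> dist (\<phi> x) (\<phi> 0) < \<phi> 0 - \<nu>"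
    using cont \<open>\<nu> < \<phi> 0\<close> unfolding continuous_on_iff by (meson diff_gt_0_iff_gt)
  then have \<eta>: "\<nu> < \<phi> x" if "0 \<le> x" "x < \<eta>" for x
    using that by (auto simp: dist_real_def dest!: bspec[of _ _ x])
  have not_negl: "\<not> negligible (superlevel \<phi> \<nu> \<inter> {0..a})" if "a > 0" for a
  proof -
    have "{0<..<min a \<eta>} \<subseteq> superlevel \<phi> \<nu> \<inter> {0..a}"
      using \<eta> by (auto simp: superlevel_def intro: less_imp_le)
    moreover have "\<not> negligible {0<..<min a \<eta>}"
      using that \<open>\<eta> > 0\<close> by (intro open_not_negligible) auto
    ultimately show ?thesis using negligible_subset by blast
  qed
  \<comment> \<open>Measurability matters here: \<open>emeasure\<close> is 0 by default on
    non-measurable sets, so non-negligibility alone would not make it nonzero.\<close>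
  have "superlevel \<phi> \<nu> \<in> sets lebesgue"
  proof -
    have "closed {x \<in> {0..}. \<nu> \<le> \<phi> x}"
      by (intro continuous_on_closed_Collect_le cont continuous_intros closed_atLeast)
    then show ?thesis by (simp add: superlevel_def lebesgue_closedin)
  qed
  moreover have "\<not> negligible (superlevel \<phi> \<nu>)"
    using not_negl[of 1] negligible_subset[of "superlevel \<phi> \<nu>"] by auto
  ultimately have nz: "emeasure lebesgue (superlevel \<phi> \<nu>) \<noteq> 0"
    unfolding negligible_iff_null_sets by (blast intro: null_setsI)
  have x: "tamp_x \<nu> \<phi> = 0"
    using tamp_x_nonneg[OF nz] negligible_below_tamp_x[OF nz, of "tamp_x \<nu> \<phi> / 2"]
      not_negl[of "tamp_x \<nu> \<phi> / 2"] by force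
  have "negligible (hollows_below \<infinity> \<phi> \<inter> {0..0})"
    by (rule negligible_subset[of "{0}"]) auto
  then have "tamp_y \<nu> \<phi> = 0" using x by (simp add: tamp_y_def negligible_imp_measure0)
  then show ?thesis using nz by (simp add: tamp_set_def)
qed

theorem proposition2p14:
  fixes \<phi> :: "real \<Rightarrow> real"
  assumes nonneg: "\<And>x. 0 \<le> x \<Longrightarrow> 0 \<le> \<phi> x"
    and cont: "continuous_on {0..} \<phi>"
    and ac: "\<And>b. 0 \<le> b \<Longrightarrow> absolutely_continuous_on {0..b} \<phi>"
  shows "ennreal (\<phi> 0) = tamping \<phi> 0"
proof (rule antisym)
  show "ennreal (\<phi> 0) \<le> tamping \<phi> 0"
  proof (rule dense_le)
    fix y :: ennreal assume "y < ennreal (\<phi> 0)"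
    \<comment> \<open>The intermediate \<open>z\<close> yields a level that is strictly positive, as
      \<open>tamping\<close> demands, even when \<open>y\<close> is 0, and that is still strictly
      below \<phi> at 0.\<close>
    then obtain z where z: "y < z" "z < ennreal (\<phi> 0)" using dense by blast
    have "z < top" using z(2) ennreal_less_top by (rule less_trans)
    then obtain \<nu> where "z = ennreal \<nu>" "0 \<le> \<nu>"
      by (cases z) auto
    moreover have "0 < z" using z(1) by (rule le_less_trans[OF zero_le])
    ultimately have \<nu>: "z = ennreal \<nu>" "0 < \<nu>" by simp_all
    then have "\<nu> < \<phi> 0" using z(2) by (simp add: ennreal_less_iff)
    then have "z \<le> tamping \<phi> 0"
      using \<nu> zero_in_tamp_set[OF cont] by (auto simp: tamping_def intro!: Sup_upper)
    then show "y \<le> tamping \<phi> 0" using z(1) by simp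
  qed
next
  \<comment> \<open>Membership of 0 excludes the empty case of \<open>tamp_set\<close>, so a level
    above \<phi> at 0 would put the left end strictly to the right of 0.\<close>
  have "\<nu> \<le> \<phi> 0" if "0 \<in> tamp_set \<nu> \<phi>" for \<nu>
    using that tamp_y_pos[OF cont ac, of \<nu>]
    by (intro leI notI) (auto simp: tamp_set_def split: if_splits)
  then show "tamping \<phi> 0 \<le> ennreal (\<phi> 0)"
    unfolding tamping_def by (intro Sup_least) (auto intro: ennreal_leI)
qed

end
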